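(* The payoff query complexity of finding an exact Nash equilibrium of a zero-sum $k \times k$ bimatrix game is $k^2$.
   Context: A $k\times k$ bimatrix game is a pair $(R,C)$ of $k\times k$ matrices: $R$ gives the payoffs of the row player and $C$ those of the column player; it is zero-sum if $C=-R$. A mixed strategy is a probability distribution over $[k]=\{1,\dots,k\}$; a mixed strategy profile is a pair $(\mathbf x,\mathbf y)$ of mixed strategies, $\mathbf x$ for the row player and $\mathbf y$ for the column player. It is an (exact, mixed) Nash equilibrium if $\max_{j\in[k]}(R_j\cdot \mathbf y)=\mathbf x\cdot R\cdot\mathbf y$ and $\max_{j\in[k]} (\mathbf x\cdot C)_j=\mathbf x\cdot C\cdot \mathbf y$. A payoff query selects a pure-strategy profile (row $r$, column $c$) and receives as response the payoffs $R_{r,c}$ and $C_{r,c}$. The payoff query complexity of a class of games with respect to a solution concept is the smallest $N$ such that there is some algorithm that, given $N$ payoff queries to any game in the class (where initially none of the payoffs are known, only the number of players and the number of pure strategies of each player), can find a solution of the game. Queries may depend on the responses to previous queries, and no computational bound is imposed on the algorithm.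
   Formalization: The statement is proved for k at least 2; for k = 1 it fails, since the only strategy profile is an equilibrium and no query is needed, so the complexity is 0 rather than 1. *)

theory Defs
  imports "HOL-Analysis.Analysis" "HOL-Library.Extended_Nat"
begin

type_synonym 'k bimatrix_game = "(real ^ 'k ^ 'k) \<times> (real ^ 'k ^ 'k)"

definition mixed_strategy :: "real ^ 'k::finite \<Rightarrow> bool" where
  "mixed_strategy x \<longleftrightarrow> (\<forall>i. 0 \<le> x $ i) \<and> (\<Sum>i\<in>UNIV. x $ i) = 1"

fun nash_equilibrium ::
    "'k::finite bimatrix_game \<Rightarrow> (real ^ 'k) \<times> (real ^ 'k) \<Rightarrow> bool" where
  "nash_equilibrium (R, C) (x, y) \<longleftrightarrow>
     mixed_strategy x \<and> mixed_strategy y \<and>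
     (MAX j. row j R \<bullet> y) = x \<bullet> (R *v y) \<and>
     (MAX j. (x v* C) $ j) = x \<bullet> (C *v y)"

definition zero_sum_games :: "'k::finite bimatrix_game set" where
  "zero_sum_games = {(R, C). C = - R}"

text \<open>A deterministic adaptive query algorithm is a decision tree: an inner node names the
  pure profile to be queried, and the subtree to continue with is an arbitrary function of the two
  payoffs received. The whole tree may depend on the number of pure strategies, since this is
  determined by the index type.\<close>

datatype ('k, 's) query_algorithm =
    Output 's
  | Query 'k 'k "real \<Rightarrow> real \<Rightarrow> ('k, 's) query_algorithm"

primrec run_output :: "('k::finite, 's) query_algorithm \<Rightarrow> 'k bimatrix_game \<Rightarrow> 's" where
  "run_output (Output s) G = s"
| "run_output (Query r c f) G = run_output (f (fst G $ r $ c) (snd G $ r $ c)) G"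

primrec run_queries :: "('k::finite, 's) query_algorithm \<Rightarrow> 'k bimatrix_game \<Rightarrow> nat" where
  "run_queries (Output s) G = 0"
| "run_queries (Query r c f) G = Suc (run_queries (f (fst G $ r $ c) (snd G $ r $ c)) G)"

definition solvable_with_queries ::
    "'k::finite bimatrix_game set \<Rightarrow> ('k bimatrix_game \<Rightarrow> 's \<Rightarrow> bool) \<Rightarrow> nat \<Rightarrow> bool" where
  "solvable_with_queries \<G> is_solution N \<longleftrightarrow>
     (\<exists>A. \<forall>G\<in>\<G>. run_queries A G \<le> N \<and> is_solution G (run_output A G))"

text \<open>The infimum is taken in the extended naturals, so it is attained if some number of queries
  suffices and is infinite otherwise.\<close>

definition payoff_query_complexity ::
    "'k::finite bimatrix_game set \<Rightarrow> ('k bimatrix_game \<Rightarrow> 's \<Rightarrow> bool) \<Rightarrow> enat" where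
  "payoff_query_complexity \<G> is_solution =
     (INF N\<in>{N. solvable_with_queries \<G> is_solution N}. enat N)"

end

theory Submission imports Defs begin

text \<open>The upper bound is the minimax theorem: once all entries are known, some equilibrium can be
  output. For the lower bound, the adversary answers according to the identity matrix, whose only
  equilibrium is uniform for both players. If the entry \<open>(r, c)\<close> is not queried, then raising it
  leaves the output unchanged, but row \<open>r\<close> becomes strictly better than the uniform strategy.\<close>

section \<open>Equilibria of zero-sum games\<close>

lemma mixed_average_le:
  assumes "mixed_strategy x" "\<And>i. f i \<le> (b::real)"
  shows "(\<Sum>i\<in>UNIV. x $ i * f i) \<le> b"
proof -
  have "(\<Sum>i\<in>UNIV. x $ i * f i) \<le> (\<Sum>i\<in>UNIV. x $ i * b)"
    using assms by (intro sum_mono mult_left_mono) (auto simp: mixed_strategy_def)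
  also have "\<dots> = b"
    using assms by (simp add: mixed_strategy_def flip: sum_distrib_right)
  finally show ?thesis .
qed

text \<open>An average never exceeds the maximum, so only the opposite inequality has content. This
  trades the \<open>MAX\<close> conditions of an equilibrium for pointwise inequalities.\<close>

lemma Max_eq_mixed_average_iff:
  fixes f :: "'k::finite \<Rightarrow> real"
  assumes "mixed_strategy x"
  shows "(MAX j. f j) = (\<Sum>i\<in>UNIV. x $ i * f i) \<longleftrightarrow> (\<forall>j. f j \<le> (\<Sum>i\<in>UNIV. x $ i * f i))"
    (is "?m = ?a \<longleftrightarrow> _")
proof
  show "\<forall>j. f j \<le> ?a" if "?m = ?a"
    using that[symmetric] by simp
  assume "\<forall>j. f j \<le> ?a"
  moreover have "?a \<le> ?m"
    using assms by (intro mixed_average_le) auto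
  ultimately show "?m = ?a"
    by (intro antisym) auto
qed

declare nash_equilibrium.simps [simp del]

text \<open>This is the saddle point form of equilibrium. The common value is an
  \<open>x\<close>-average of the entries of \<open>R *v y\<close> and also a
  \<open>y\<close>-average of those of \<open>x v* R\<close>, so
  \<open>Max_eq_mixed_average_iff\<close> applies once per player, with a sign change for the column
  player.\<close>

lemma nash_equilibrium_zero_sum_iff:
  "nash_equilibrium (R, - R) (x, y) \<longleftrightarrow> mixed_strategy x \<and> mixed_strategy y \<and>
     (\<forall>i. (R *v y) $ i \<le> x \<bullet> (R *v y)) \<and> (\<forall>j. x \<bullet> (R *v y) \<le> (x v* R) $ j)"
proof -
  have row: "row j R \<bullet> y = (R *v y) $ j" for j
    by (simp add: matrix_vector_mult_def inner_vec_def row_def)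
  have x: "x \<bullet> (R *v y) = (\<Sum>i\<in>UNIV. x $ i * (R *v y) $ i)"
    by (simp add: inner_vec_def)
  have col: "(x v* (- R)) $ j = - (x v* R) $ j" for j
    by (simp add: vector_matrix_mult_def sum_negf)
  have minus: "(- R) *v y = - (R *v y)"
    by (simp add: matrix_vector_mult_def vec_eq_iff sum_negf)
  have "x \<bullet> (R *v y) = (x v* R) \<bullet> y"
    by (simp add: dot_lmul_matrix)
  hence y: "- (x \<bullet> (R *v y)) = (\<Sum>j\<in>UNIV. y $ j * - (x v* R) $ j)"
    by (simp add: inner_vec_def sum_negf mult.commute)
  show ?thesis
    unfolding nash_equilibrium.simps row col minus inner_minus_right
    unfolding y
    using Max_eq_mixed_average_iff[of x "\<lambda>i. (R *v y) $ i"]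
      Max_eq_mixed_average_iff[of y "\<lambda>j. - (x v* R) $ j"]
    unfolding x[symmetric] y[symmetric] by auto
qed

section \<open>The strategy simplex and the minimax theorem\<close>

lemma compact_mixed_strategies: "compact {x :: real ^ 'k::finite. mixed_strategy x}"
proof -
  have "norm x \<le> 1" if "mixed_strategy x" for x :: "real ^ 'k"
    using norm_le_l1_cart[of x] that by (simp add: mixed_strategy_def)
  moreover have "closed {x :: real ^ 'k. mixed_strategy x}"
    unfolding mixed_strategy_def
    by (intro closed_Collect_conj closed_Collect_all closed_Collect_le closed_Collect_eq
        continuous_intros)
  ultimately show ?thesis
    by (auto simp: compact_eq_bounded_closed bounded_iff)
qed

lemma convex_mixed_strategies: "convex {x :: real ^ 'k::finite. mixed_strategy x}"
  by (auto simp: convex_def mixed_strategy_def sum.distrib simp flip: sum_distrib_left)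

lemma mixed_strategy_axis: "mixed_strategy (axis i 1 :: real ^ 'k::finite)"
  by (simp add: mixed_strategy_def axis_def)

lemma continuous_on_Max_image:
  fixes f :: "'i \<Rightarrow> 'a::topological_space \<Rightarrow> real"
  assumes "finite I" "I \<noteq> {}" "\<And>i. i \<in> I \<Longrightarrow> continuous_on S (f i)"
  shows "continuous_on S (\<lambda>x. Max ((\<lambda>i. f i x) ` I))"
  using assms by (induction rule: finite_ne_induct) (auto intro: continuous_on_max)

text \<open>The minimax strategy \<open>y\<close> of the column player exists by compactness. The strategy \<open>x\<close> is the
  normal of a hyperplane separating the payoff vectors \<open>R *v y'\<close> from the open orthant of vectors
  that are everywhere below the minimax value.\<close>

lemma zero_sum_equilibrium_exists:
  fixes R :: "real ^ 'k::finite ^ 'k"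
  shows "\<exists>s. nash_equilibrium (R, - R) s"
proof -
  define \<Delta> where "\<Delta> = {y :: real ^ 'k. mixed_strategy y}"
  define g where "g = (\<lambda>y. MAX i. (R *v y) $ i)"
  have "continuous_on \<Delta> g"
    unfolding g_def by (intro continuous_on_Max_image continuous_intros) auto
  moreover have ne: "\<Delta> \<noteq> {}"
    unfolding \<Delta>_def using mixed_strategy_axis by blast
  moreover have "compact \<Delta>"
    unfolding \<Delta>_def by (rule compact_mixed_strategies)
  ultimately obtain y where y: "y \<in> \<Delta>" and y_min: "\<And>y'. y' \<in> \<Delta> \<Longrightarrow> g y \<le> g y'"
    using continuous_attains_inf[of \<Delta> g] by blast
  define v where "v = g y"
  have v: "(R *v y) $ i \<le> v" for i
    unfolding v_def g_def by simp
  define S where "S = {z :: real ^ 'k. \<forall>i. z $ i < v}"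
  have "convex S"
    unfolding S_def by (auto simp: convex_def intro!: convex_bound_lt)
  moreover have "convex ((*v) R ` \<Delta>)"
    unfolding \<Delta>_def by (intro convex_linear_image convex_mixed_strategies) simp
  moreover have "S \<noteq> {}"
  proof -
    have "vec (v - 1) \<in> S"
      by (simp add: S_def)
    thus ?thesis
      by blast
  qed
  moreover have "S \<inter> (*v) R ` \<Delta> = {}"
  proof -
    \<comment> \<open>By minimality of \<open>y\<close>, the largest entry of \<open>R *v y'\<close>
      is at least \<open>v\<close>.\<close>
    have "\<not> (\<forall>i. (R *v y') $ i < v)" if "y' \<in> \<Delta>" for y'
      using y_min[OF that] unfolding v_def[symmetric] unfolding g_def
      by (auto simp: Max_ge_iff not_less)
    thus ?thesis
      by (auto simp: S_def)
  qed
  ultimately obtain a b where a: "a \<noteq> 0" and le_b: "\<And>z. z \<in> S \<Longrightarrow> a \<bullet> z \<le> b"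
    and ge_b: "\<And>y'. y' \<in> \<Delta> \<Longrightarrow> b \<le> a \<bullet> (R *v y')"
    using separating_hyperplane_sets[of S "(*v) R ` \<Delta>"] ne
    by (metis (no_types, lifting) image_is_empty imageI)
  define s where "s = (\<Sum>i\<in>UNIV. a $ i)"
  have dot_vec: "a \<bullet> vec t = t * s" for t
    by (simp add: inner_vec_def s_def sum_distrib_left mult.commute)
  have a_nonneg: "0 \<le> a $ i" for i
  proof (rule ccontr)
    assume neg: "\<not> 0 \<le> a $ i"
    \<comment> \<open>Moving from \<open>vec (v - 1)\<close> by \<open>t\<close> in direction
      \<open>- axis i 1\<close> stays inside \<open>S\<close>. If \<open>a $ i\<close> were
      negative, this \<open>t\<close> would raise the inner product with \<open>a\<close> to at
      least \<open>b + 1\<close>.\<close>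
    define t where "t = (\<bar>b - (v - 1) * s\<bar> + 1) / - a $ i"
    have "0 \<le> t"
      using neg by (auto simp: t_def intro!: divide_nonneg_neg divide_nonneg_pos)
    hence "vec (v - 1) - t *\<^sub>R axis i 1 \<in> S"
      by (auto simp: S_def axis_def)
    from le_b[OF this] have "(v - 1) * s - t * a $ i \<le> b"
      by (simp add: inner_diff_right dot_vec inner_axis)
    moreover have "- (t * a $ i) = \<bar>b - (v - 1) * s\<bar> + 1"
      using neg by (simp add: t_def)
    ultimately show False
      by linarith
  qed
  have "s > 0"
  proof -
    obtain i where "a $ i \<noteq> 0"
      using a by (auto simp: vec_eq_iff)
    thus ?thesis
      unfolding s_def using a_nonneg by (intro sum_pos2[of _ i]) (auto simp: order_less_le)
  qed
  \<comment> \<open>The point \<open>vec v\<close> lies only on the boundary of \<open>S\<close>, so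
    it is approached by \<open>vec (v - e / s)\<close>, whose inner product with \<open>a\<close> is
    \<open>v * s - e\<close>.\<close>
  have "v * s \<le> b"
  proof (rule field_le_epsilon)
    fix e :: real assume "e > 0"
    with \<open>s > 0\<close> have "vec (v - e / s) \<in> S"
      by (simp add: S_def)
    from le_b[OF this] show "v * s \<le> b + e"
      using \<open>s > 0\<close> by (simp add: dot_vec algebra_simps)
  qed
  define x where "x = (1 / s) *\<^sub>R a"
  have mixed_x: "mixed_strategy x"
    using \<open>s > 0\<close> a_nonneg
    by (auto simp: mixed_strategy_def x_def simp flip: sum_divide_distrib s_def)
  have x_ge: "v \<le> x \<bullet> (R *v y')" if "y' \<in> \<Delta>" for y'
    using order_trans[OF \<open>v * s \<le> b\<close> ge_b[OF that]] \<open>s > 0\<close>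
    by (simp add: x_def field_simps)
  have "x \<bullet> (R *v y) \<le> v"
    unfolding inner_vec_def inner_real_def by (rule mixed_average_le[OF mixed_x v])
  with x_ge[OF y] have value_eq: "x \<bullet> (R *v y) = v"
    by simp
  \<comment> \<open>The bound \<open>x_ge\<close> is applied to the pure column
    \<open>j\<close>.\<close>
  have "v \<le> (x v* R) $ j" for j
    using x_ge[of "axis j 1"] mixed_strategy_axis[of j]
    by (simp add: \<Delta>_def inner_axis flip: dot_lmul_matrix)
  with v mixed_x y have "nash_equilibrium (R, - R) (x, y)"
    by (simp add: nash_equilibrium_zero_sum_iff value_eq \<Delta>_def)
  thus ?thesis ..
qed

section \<open>The uniform equilibrium of the identity game\<close>

text \<open>Both \<open>x\<close> and the uniform vector sum to 1, so under a one-sided bound a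
  single strict inequality would make the sums differ.\<close>

lemma mixed_strategy_constant:
  fixes x :: "real ^ 'k::finite"
  assumes "mixed_strategy x" "(\<forall>i. x $ i \<le> 1 / CARD('k)) \<or> (\<forall>i. 1 / CARD('k) \<le> x $ i)"
  shows "x $ i = 1 / CARD('k)"
proof (rule ccontr)
  assume *: "x $ i \<noteq> 1 / CARD('k)"
  have "(\<Sum>i\<in>UNIV. x $ i) = (\<Sum>i\<in>(UNIV :: 'k set). 1 / CARD('k))"
    using assms(1) by (simp add: mixed_strategy_def)
  moreover have "(\<Sum>i\<in>UNIV. x $ i) < (\<Sum>i\<in>(UNIV :: 'k set). 1 / CARD('k))
      \<or> (\<Sum>i\<in>(UNIV :: 'k set). 1 / CARD('k)) < (\<Sum>i\<in>UNIV. x $ i)"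
    using assms(2)
  proof (elim disj_forward)
    assume "\<forall>i. x $ i \<le> 1 / CARD('k)"
    with * show "(\<Sum>i\<in>UNIV. x $ i) < (\<Sum>i\<in>(UNIV :: 'k set). 1 / CARD('k))"
      by (intro sum_strict_mono_ex1) (auto simp: order_less_le)
  next
    assume "\<forall>i. 1 / CARD('k) \<le> x $ i"
    with * show "(\<Sum>i\<in>(UNIV :: 'k set). 1 / CARD('k)) < (\<Sum>i\<in>UNIV. x $ i)"
      by (intro sum_strict_mono_ex1) (auto simp: order_less_le intro!: exI[of _ i])
  qed
  ultimately show False
    by linarith
qed

text \<open>For the identity matrix the value \<open>x \<bullet> y\<close> bounds all entries of
  \<open>y\<close> from above and all entries of \<open>x\<close> from below. Summing both bounds
  forces the value to be \<open>1 / CARD('k)\<close>.\<close>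

lemma nash_equilibrium_identity_uniform:
  fixes x y :: "real ^ 'k::finite"
  assumes "nash_equilibrium (mat 1, - mat 1) (x, y)"
  shows "x $ i = 1 / CARD('k)" "y $ i = 1 / CARD('k)"
proof -
  have mixed: "mixed_strategy x" "mixed_strategy y"
    and le: "\<And>i. y $ i \<le> x \<bullet> y" "\<And>j. x \<bullet> y \<le> x $ j"
    using assms by (auto simp: nash_equilibrium_zero_sum_iff)
  have "1 \<le> CARD('k) * (x \<bullet> y)"
    using sum_mono[of UNIV "\<lambda>i. y $ i" "\<lambda>_. x \<bullet> y"] mixed(2) le(1)
    by (simp add: mixed_strategy_def)
  moreover have "CARD('k) * (x \<bullet> y) \<le> 1"
    using sum_mono[of UNIV "\<lambda>_. x \<bullet> y" "\<lambda>i. x $ i"] mixed(1) le(2)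
    by (simp add: mixed_strategy_def)
  ultimately have "x \<bullet> y = 1 / CARD('k)"
    by (simp add: field_simps)
  with le mixed show "x $ i = 1 / CARD('k)" "y $ i = 1 / CARD('k)"
    by (auto intro!: mixed_strategy_constant)
qed

section \<open>Query algorithms\<close>

text \<open>A non-adaptive algorithm: \<open>g\<close> is the table of responses recorded so far,
  and \<open>f\<close> turns the final table into the output.\<close>

primrec query_list ::
    "('k \<times> 'k) list \<Rightarrow> ('k \<times> 'k \<Rightarrow> real \<times> real) \<Rightarrow> (('k \<times> 'k \<Rightarrow> real \<times> real) \<Rightarrow> 's)
      \<Rightarrow> ('k, 's) query_algorithm" where
  "query_list [] g f = Output (f g)"
| "query_list (p # ps) g f =
     Query (fst p) (snd p) (\<lambda>a b. query_list ps (g(p := (a, b))) f)"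

lemma run_queries_query_list: "run_queries (query_list ps g f) G = length ps"
  by (induction ps arbitrary: g) auto

lemma run_output_query_list:
  "run_output (query_list ps g f) G =
     f (\<lambda>p. if p \<in> set ps then (fst G $ fst p $ snd p, snd G $ fst p $ snd p) else g p)"
  by (induction ps arbitrary: g) (auto intro!: arg_cong[where f = f])

lemma solvable_with_all_queries:
  fixes is_solution :: "'k::finite bimatrix_game \<Rightarrow> 's \<Rightarrow> bool"
  assumes "\<And>G. G \<in> \<G> \<Longrightarrow> \<exists>s. is_solution G s"
  shows "solvable_with_queries \<G> is_solution (CARD('k) ^ 2)"
proof -
  obtain ps :: "('k \<times> 'k) list" where ps: "set ps = UNIV" "distinct ps"
    using finite_distinct_list[of "UNIV :: ('k \<times> 'k) set"] by auto
  \<comment> \<open>The table is reassembled into a game and a solution is picked by choice, which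
    is legitimate because computation is unbounded.\<close>
  define f where "f = (\<lambda>g :: 'k \<times> 'k \<Rightarrow> real \<times> real. SOME s. is_solution
    (\<chi> r c. fst (g (r, c)), \<chi> r c. snd (g (r, c))) s)"
  have "run_output (query_list ps g f) G = (SOME s. is_solution G s)" for g G
    by (simp add: run_output_query_list ps f_def)
  moreover have "length ps = CARD('k) ^ 2"
    using distinct_card[OF ps(2)] ps(1) by (simp add: card_prod power2_eq_square)
  ultimately show ?thesis
    unfolding solvable_with_queries_def
    \<comment> \<open>The initial table is arbitrary, since \<open>ps\<close> contains every profile
      and so every entry is overwritten.\<close>
    using assms by (intro exI[of _ "query_list ps undefined f"])
      (auto simp: run_queries_query_list intro: someI_ex)
qed

section \<open>The adversary lower bound\<close>

text \<open>Let \<open>Q\<close> be the set of profiles queried when \<open>A\<close> runs on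
  \<open>G\<close>. A game agreeing with \<open>G\<close> on \<open>Q\<close> follows the same path
  to the same leaf, and too few queries leave some profile outside \<open>Q\<close>.\<close>

lemma unqueried_entry_exists:
  fixes G :: "'k::finite bimatrix_game"
  assumes "run_queries A G < CARD('k) ^ 2"
  shows "\<exists>r c. \<forall>G'. (\<forall>i j. (i, j) \<noteq> (r, c) \<longrightarrow> fst G' $ i $ j = fst G $ i $ j
      \<and> snd G' $ i $ j = snd G $ i $ j) \<longrightarrow> run_output A G' = run_output A G"
proof -
  have "\<exists>Q. finite Q \<and> card Q \<le> run_queries A G \<and>
      (\<forall>G'. (\<forall>(i, j)\<in>Q. fst G' $ i $ j = fst G $ i $ j \<and> snd G' $ i $ j = snd G $ i $ j)
        \<longrightarrow> run_output A G' = run_output A G)"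
  proof (induction A)
    case (Output s)
    show ?case by (intro exI[of _ "{}"]) simp
  next
    case (Query r c f)
    \<comment> \<open>The induction hypothesis covers all subtrees; the relevant one is selected by
      the responses of \<open>G\<close>.\<close>
    obtain Q where Q: "finite Q"
      "card Q \<le> run_queries (f (fst G $ r $ c) (snd G $ r $ c)) G"
      "\<And>G'. (\<forall>(i, j)\<in>Q. fst G' $ i $ j = fst G $ i $ j \<and> snd G' $ i $ j = snd G $ i $ j)
        \<Longrightarrow> run_output (f (fst G $ r $ c) (snd G $ r $ c)) G'
          = run_output (f (fst G $ r $ c) (snd G $ r $ c)) G"
      using Query[OF rangeI rangeI] by blast
    show ?case
    proof (intro exI[of _ "insert (r, c) Q"] conjI allI impI)
      show "card (insert (r, c) Q) \<le> run_queries (Query r c f) G"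
        using Q(1,2) by (simp add: card_insert_if)
      fix G' :: "'k bimatrix_game"
      assume "\<forall>(i, j)\<in>insert (r, c) Q.
        fst G' $ i $ j = fst G $ i $ j \<and> snd G' $ i $ j = snd G $ i $ j"
      thus "run_output (Query r c f) G' = run_output (Query r c f) G"
        using Q(3)[of G'] by simp
    qed (use Q(1) in simp)
  qed
  then obtain Q where Q: "finite Q" "card Q \<le> run_queries A G"
    "\<And>G'. (\<forall>(i, j)\<in>Q. fst G' $ i $ j = fst G $ i $ j \<and> snd G' $ i $ j = snd G $ i $ j)
        \<Longrightarrow> run_output A G' = run_output A G"
    by blast
  have "Q \<noteq> UNIV"
    using Q(2) assms by (auto simp: card_prod power2_eq_square)
  then obtain r c where "(r, c) \<notin> Q"
    by auto
  thus ?thesis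
    by (intro exI[of _ r] exI[of _ c] allI impI Q(3)) auto
qed

lemma zero_sum_queries_lower_bound:
  assumes "CARD('k::finite) \<ge> 2"
    and "solvable_with_queries (zero_sum_games :: 'k bimatrix_game set) nash_equilibrium N"
  shows "CARD('k) ^ 2 \<le> N"
proof (rule ccontr)
  assume "\<not> CARD('k) ^ 2 \<le> N"
  obtain A where A: "\<And>G :: 'k bimatrix_game. G \<in> zero_sum_games \<Longrightarrow>
      run_queries A G \<le> N \<and> nash_equilibrium G (run_output A G)"
    using assms(2) unfolding solvable_with_queries_def by blast
  define I where "I = (mat 1 :: real ^ 'k ^ 'k)"
  have I: "run_queries A (I, - I) \<le> N" "nash_equilibrium (I, - I) (run_output A (I, - I))"
    using A[of "(I, - I)"] by (auto simp: zero_sum_games_def)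
  obtain x y where xy: "run_output A (I, - I) = (x, y)"
    by fastforce
  have unif: "x $ i = 1 / CARD('k)" "y $ i = 1 / CARD('k)" for i
    using nash_equilibrium_identity_uniform[of x y] I(2)[unfolded xy] by (simp_all add: I_def)
  have "run_queries A (I, - I) < CARD('k) ^ 2"
    using I(1) \<open>\<not> _\<close> by simp
  then obtain r c where rc: "\<forall>G'. (\<forall>i j. (i, j) \<noteq> (r, c) \<longrightarrow> fst G' $ i $ j = fst (I, - I) $ i $ j
      \<and> snd G' $ i $ j = snd (I, - I) $ i $ j) \<longrightarrow> run_output A G' = run_output A (I, - I)"
    using unqueried_entry_exists[of A "(I, - I)"] by blast
  \<comment> \<open>Raising one entry of \<open>I\<close> by 1 changes both payoffs, but only at the
    unqueried profile, and \<open>(R, - R)\<close> is still zero-sum.\<close>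
  define R where "R = I + (\<chi> i j. if i = r \<and> j = c then 1 else 0)"
  have "run_output A (R, - R) = (x, y)"
    unfolding xy[symmetric] by (rule rc[rule_format]) (auto simp: R_def)
  hence nash: "nash_equilibrium (R, - R) (x, y)"
    using A[of "(R, - R)"] by (auto simp: zero_sum_games_def)
  \<comment> \<open>Against uniform \<open>y\<close> every row of \<open>I\<close> earns
    \<open>1 / CARD('k)\<close>, and the raised entry adds the same amount to row
    \<open>r\<close>.\<close>
  have Ry: "(R *v y) $ i = (1 + of_bool (i = r)) / CARD('k)" for i
  proof -
    have "(R *v y) $ i = (I *v y) $ i + (\<Sum>j\<in>UNIV. (if i = r \<and> j = c then 1 else 0) * y $ j)"
      by (simp add: R_def matrix_vector_mult_def algebra_simps sum.distrib)
    also have "(\<Sum>j\<in>UNIV. (if i = r \<and> j = c then 1 else 0) * y $ j) = of_bool (i = r) * y $ c"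
      by (cases "i = r") (auto simp: if_distrib[where f = "\<lambda>t. t * _"] cong: if_cong)
    finally show ?thesis
      by (simp add: I_def unif add_divide_distrib)
  qed
  \<comment> \<open>A second row earns strictly less than row \<open>r\<close>, which pulls the
    uniform average below it. With a single strategy there is no such row, and the only profile
    could be output without any query.\<close>
  obtain i where "i \<noteq> r"
    using assms(1) by (metis (full_types) One_nat_def UNIV_eq_I card_1_singleton_iff insertI1
        not_less_eq_eq numeral_2_eq_2 order_refl)
  have "x \<bullet> (R *v y) < (R *v y) $ r"
  proof -
    have "x \<bullet> (R *v y) = (\<Sum>i\<in>UNIV. 1 / CARD('k) * (R *v y) $ i)"
      by (simp add: inner_vec_def unif)
    also have "\<dots> < (\<Sum>i\<in>(UNIV :: 'k set). 1 / CARD('k) * (R *v y) $ r)"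
      using \<open>i \<noteq> r\<close> by (intro sum_strict_mono_ex1) (auto simp: Ry divide_simps intro!: exI[of _ i])
    finally show ?thesis
      by simp
  qed
  moreover have "(R *v y) $ r \<le> x \<bullet> (R *v y)"
    using nash by (simp add: nash_equilibrium_zero_sum_iff)
  ultimately show False
    by simp
qed

theorem theorem4:
  assumes "CARD('k::finite) \<ge> 2"
  shows "payoff_query_complexity (zero_sum_games :: 'k bimatrix_game set) nash_equilibrium
           = enat (CARD('k) ^ 2)"
  unfolding payoff_query_complexity_def
proof (rule antisym)
  have "solvable_with_queries (zero_sum_games :: 'k bimatrix_game set) nash_equilibrium
      (CARD('k) ^ 2)"
    using zero_sum_equilibrium_exists
    by (intro solvable_with_all_queries) (auto simp: zero_sum_games_def)
  thus "(INF N\<in>{N. solvable_with_queries (zero_sum_games :: 'k bimatrix_game set)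
      nash_equilibrium N}. enat N) \<le> enat (CARD('k) ^ 2)"
    by (intro INF_lower) simp
next
  show "enat (CARD('k) ^ 2) \<le> (INF N\<in>{N. solvable_with_queries
      (zero_sum_games :: 'k bimatrix_game set) nash_equilibrium N}. enat N)"
    using zero_sum_queries_lower_bound[OF assms] by (intro INF_greatest) simp
qed

end
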